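(* For every $n\ge0$, there is a one-to-one correspondence between the set of chains in plane trees with $n$ edges and the set of tricolored plane trees with $n$ edges.
   Context: A plane tree is a rooted tree with linearly ordered children. A chain in a plane tree is a nonempty set of vertices all lying on a single path from the root to a leaf; chains in plane trees with $n$ edges are pairs $(T,Q)$ with $T$ a plane tree with $n$ edges and $Q$ a chain of $T$. A tricolored plane tree is a plane tree in which each child of the root is colored with one of three colors (no other vertex is colored). *)

theory Defs
  imports Main "HOL-Library.Sublist" "HOL-Library.FuncSet"
begin

datatype plane_tree = Node (subtrees: "plane_tree list")

fun num_edges :: "plane_tree \<Rightarrow> nat" where
  "num_edges (Node ts) = (\<Sum>t\<leftarrow>ts. Suc (num_edges t))"

text \<open>
  A vertex is identified with its address: the list of child indices leading to it from the root.
  Thus the root is \<^term>\<open>[]\<close>, and the \<open>i\<close>-th child (counted from 0) of \<open>v\<close> is \<open>v @ [i]\<close>.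
\<close>

fun is_address :: "plane_tree \<Rightarrow> nat list \<Rightarrow> bool" where
  "is_address T [] \<longleftrightarrow> True"
| "is_address (Node ts) (i # p) \<longleftrightarrow> i < length ts \<and> is_address (ts ! i) p"

definition vertices :: "plane_tree \<Rightarrow> nat list set" where
  "vertices T = {v. is_address T v}"

definition children :: "plane_tree \<Rightarrow> nat list \<Rightarrow> nat list set" where
  "children T v = {w \<in> vertices T. \<exists>i. w = v @ [i]}"

definition leaves :: "plane_tree \<Rightarrow> nat list set" where
  "leaves T = {v \<in> vertices T. children T v = {}}"

definition path_from_root :: "nat list \<Rightarrow> nat list set" where
  "path_from_root v = {u. prefix u v}"

definition is_chain :: "plane_tree \<Rightarrow> nat list set \<Rightarrow> bool" where
  "is_chain T Q \<longleftrightarrow> Q \<noteq> {} \<and> Q \<subseteq> vertices T \<and> (\<exists>l \<in> leaves T. Q \<subseteq> path_from_root l)"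

definition chains_in_plane_trees :: "nat \<Rightarrow> (plane_tree \<times> nat list set) set" where
  "chains_in_plane_trees n = {(T, Q). num_edges T = n \<and> is_chain T Q}"

datatype color = Red | Green | Blue

text \<open>
  A coloring is extensional, i.e. \<^term>\<open>undefined\<close> away from the children of the root, so that
  distinct functions represent distinct colorings.
\<close>

definition tricolored_plane_trees :: "nat \<Rightarrow> (plane_tree \<times> (nat list \<Rightarrow> color)) set" where
  "tricolored_plane_trees n =
     {(T, c). num_edges T = n \<and> c \<in> children T [] \<rightarrow>\<^sub>E (UNIV :: color set)}"

lemma vertices_Node:
  "vertices (Node ts) = insert [] (\<Union>i<length ts. (#) i ` vertices (ts ! i))"
proof (rule set_eqI)
  fix v show "v \<in> vertices (Node ts) \<longleftrightarrow> v \<in> insert [] (\<Union>i<length ts. (#) i ` vertices (ts ! i))"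
    by (cases v) (auto simp: vertices_def)
qed

lemma finite_vertices: "finite (vertices T)"
proof (induction T)
  case (Node ts)
  then show ?case by (auto simp: vertices_Node)
qed

lemma card_vertices: "card (vertices T) = Suc (num_edges T)"
proof (induction T)
  case (Node ts)
  have "card (\<Union>i<length ts. (#) i ` vertices (ts ! i))
      = (\<Sum>i<length ts. card ((#) i ` vertices (ts ! i)))"
    by (rule card_UN_disjoint) (auto simp: finite_vertices)
  also have "\<dots> = (\<Sum>i<length ts. Suc (num_edges (ts ! i)))"
    using Node by (intro sum.cong) (auto simp: card_image)
  also have "\<dots> = num_edges (Node ts)"
    by (simp add: sum_list_sum_nth atLeast0LessThan)
  finally show ?case
    unfolding vertices_Node by (subst card_insert_disjoint) (auto simp: finite_vertices)
qed

end

theory Submission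
  imports Defs
begin

text \<open>
  Both families decompose in the same way.  Cut a chain at the root: either it consists of the
  root alone, or its remaining vertices lie in one subtree, and one records whether the root
  belongs to the chain, the siblings to the left and to the right of that subtree, and the chain
  inside it.  Cut a tricolored tree at the first child of the root that is not red: either there
  is none, or one records its color (one bit), the red children before it, its own subtrees, and
  the tricolored tree formed by the children after it.  Iterating, both kinds of objects are
  encoded by the same sequences.
\<close>

datatype spine =
    Tip "plane_tree list"
  | Step bool "plane_tree list" "plane_tree list" spine

fun spine_tree :: "spine \<Rightarrow> plane_tree" where
  "spine_tree (Tip us) = Node us"
| "spine_tree (Step b ls rs s) = Node (ls @ spine_tree s # rs)"

text \<open>\<open>Tip\<close> is the deepest vertex of the chain, so the encoded path stops exactly
  where the chain does. This makes the code of a chain unique.\<close>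

fun spine_chain :: "spine \<Rightarrow> nat list set" where
  "spine_chain (Tip us) = {[]}"
| "spine_chain (Step b ls rs s) = (if b then {[]} else {}) \<union> (#) (length ls) ` spine_chain s"

text \<open>A tricolored tree is handled as the list of its root's children with their colors. The
  right siblings \<open>rs\<close> of the path become the subtrees of a non-red child, and
  \<open>us\<close> becomes the final run of red children.\<close>

fun spine_colored :: "spine \<Rightarrow> (color \<times> plane_tree) list" where
  "spine_colored (Tip us) = map (Pair Red) us"
| "spine_colored (Step b ls rs s) =
     map (Pair Red) ls @ (if b then Green else Blue, Node rs) # spine_colored s"

definition colored_edges :: "(color \<times> plane_tree) list \<Rightarrow> nat" where
  "colored_edges xs = num_edges (Node (map snd xs))"

text \<open>In each \<open>Step\<close>, the edge down to \<open>spine_tree s\<close> is traded for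
  the edge to the non-red child \<open>Node rs\<close>.\<close>

lemma colored_edges_spine_colored: "colored_edges (spine_colored s) = num_edges (spine_tree s)"
  by (induction s) (auto simp: colored_edges_def comp_def)

lemma vertex_below_leaf:
  assumes "v \<in> vertices T"
  shows "\<exists>l \<in> leaves T. prefix v l"
proof -
  let ?D = "{w \<in> vertices T. prefix v w}"
  have "finite ?D" "v \<in> ?D"
    using assms by (auto simp: finite_vertices)
  then obtain l where l: "l \<in> ?D" and max: "\<And>w. w \<in> ?D \<Longrightarrow> length w \<le> length l"
    using Max_in[of "length ` ?D"] Max_ge[of "length ` ?D"] by fastforce
  \<comment> \<open>A child of \<open>l\<close> would be a longer address extending
    \<open>v\<close>, against the maximality of \<open>l\<close>.\<close>
  have "children T l = {}"
    using l max unfolding children_def by fastforce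
  then show ?thesis
    using l by (auto simp: leaves_def)
qed

lemma is_address_prefix: "is_address T v \<Longrightarrow> prefix u v \<Longrightarrow> is_address T u"
  by (induction T v arbitrary: u rule: is_address.induct) (auto simp: prefix_Cons)

text \<open>Any vertex lies above a leaf, and prefixes of addresses are addresses. Unlike the leaf
  condition, the bounding vertex \<open>v\<close> passes easily between a tree and its
  subtrees.\<close>

lemma is_chain_iff:
  "is_chain T Q \<longleftrightarrow> Q \<noteq> {} \<and> (\<exists>v \<in> vertices T. \<forall>u \<in> Q. prefix u v)"
proof
  assume "is_chain T Q"
  then show "Q \<noteq> {} \<and> (\<exists>v \<in> vertices T. \<forall>u \<in> Q. prefix u v)"
    by (auto simp: is_chain_def leaves_def path_from_root_def)
next
  assume R: "Q \<noteq> {} \<and> (\<exists>v \<in> vertices T. \<forall>u \<in> Q. prefix u v)"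
  then obtain v where v: "v \<in> vertices T" "\<forall>u \<in> Q. prefix u v"
    by blast
  obtain l where l: "l \<in> leaves T" "prefix v l"
    using vertex_below_leaf[OF v(1)] by blast
  have "Q \<subseteq> vertices T"
    using v is_address_prefix by (auto simp: vertices_def)
  moreover have "Q \<subseteq> path_from_root l"
    using v(2) l(2) prefix_order.trans by (auto simp: path_from_root_def)
  ultimately show "is_chain T Q"
    using R l(1) unfolding is_chain_def by blast
qed

lemma spine_chain_nonempty: "spine_chain s \<noteq> {}"
  by (induction s) auto

lemma is_chain_spine: "is_chain (spine_tree s) (spine_chain s)"
proof (induction s)
  case (Tip us)
  then show ?case
    by (auto simp: is_chain_iff vertices_def intro!: exI[of _ "[]"])
next
  case (Step b ls rs s)
  then obtain v where "v \<in> vertices (spine_tree s)" "\<forall>u \<in> spine_chain s. prefix u v"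
    by (auto simp: is_chain_iff)
  then show ?case
    using spine_chain_nonempty[of "Step b ls rs s"]
    by (auto simp: is_chain_iff vertices_def intro!: exI[of _ "length ls # v"])
qed

lemma is_chain_imp_spine:
  "is_chain T Q \<Longrightarrow> \<exists>s. spine_tree s = T \<and> spine_chain s = Q"
proof (induction T arbitrary: Q)
  case (Node ts)
  then obtain v where ne: "Q \<noteq> {}" and v: "is_address (Node ts) v" "\<forall>u \<in> Q. prefix u v"
    by (auto simp: is_chain_iff vertices_def)
  show ?case
  proof (cases "Q = {[]}")
    case True
    then have "spine_tree (Tip ts) = Node ts \<and> spine_chain (Tip ts) = Q"
      by simp
    then show ?thesis by blast
  next
    case False
    with ne obtain u where u: "u \<in> Q" "u \<noteq> []"
      by blast
    \<comment> \<open>A non-root member forces \<open>v\<close> off the root; its first index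
      selects the subtree that contains all non-root members.\<close>
    with v obtain i p where ip: "v = i # p" "i < length ts" "is_address (ts ! i) p"
      by (cases v) auto
    define R where "R = {w. i # w \<in> Q}"
    have Q: "Q = (if [] \<in> Q then {[]} else {}) \<union> (#) i ` R"
      using v(2) ip(1) unfolding R_def by (auto simp: prefix_Cons)
    have "R \<noteq> {}"
      using u Q by (auto split: if_splits)
    moreover have "\<forall>w \<in> R. prefix w p"
      using v(2) ip(1) by (auto simp: R_def)
    ultimately have "is_chain (ts ! i) R"
      using ip(3) by (auto simp: is_chain_iff vertices_def)
    then obtain s where s: "spine_tree s = ts ! i" "spine_chain s = R"
      using Node.IH[of "ts ! i" R] ip(2) by auto
    let ?s = "Step ([] \<in> Q) (take i ts) (drop (Suc i) ts) s"
    have "spine_tree ?s = Node ts"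
      using s ip(2) by (simp add: id_take_nth_drop[symmetric])
    moreover have "spine_chain ?s = Q"
      using s ip(2) Q by (simp add: min_absorb2)
    ultimately show ?thesis by blast
  qed
qed

text \<open>The chain reveals the first index of the path, hence where the root's list of subtrees
  splits, and membership of \<open>[]\<close> reveals the bit.\<close>

lemma spine_eqI:
  "spine_tree s = spine_tree s' \<Longrightarrow> spine_chain s = spine_chain s' \<Longrightarrow> s = s'"
proof (induction s arbitrary: s')
  case (Tip us)
  then show ?case
    using spine_chain_nonempty by (cases s') (auto split: if_splits)
next
  case (Step b ls rs s)
  obtain w where w: "w \<in> spine_chain s"
    using spine_chain_nonempty by blast
  \<comment> \<open>This nonempty address excludes \<open>Tip\<close> for \<open>s'\<close>, and its
    head must equal the length of the left list of \<open>s'\<close>.\<close>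
  have "length ls # w \<in> spine_chain s'"
    using Step.prems(2) w by (metis UnI2 imageI spine_chain.simps(2))
  then obtain b' ls' rs' t where s': "s' = Step b' ls' rs' t" and len: "length ls = length ls'"
    by (cases s') (auto split: if_splits)
  have tree: "ls = ls'" "spine_tree s = spine_tree t" "rs = rs'"
    using Step.prems(1) len by (simp_all add: s')
  have "b \<longleftrightarrow> [] \<in> spine_chain (Step b ls rs s)" "b' \<longleftrightarrow> [] \<in> spine_chain (Step b' ls' rs' t)"
    by auto
  then have "b = b'"
    using Step.prems(2) unfolding s' by blast
  moreover have "{w. length ls # w \<in> spine_chain (Step b ls rs s)} = spine_chain s"
    "{w. length ls # w \<in> spine_chain (Step b' ls' rs' t)} = spine_chain t"
    using len by auto
  then have "spine_chain s = spine_chain t"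
    using Step.prems(2) unfolding s' by metis
  ultimately show ?case
    using Step.IH tree s' by simp
qed

lemma bij_betw_spine_chains:
  "bij_betw (\<lambda>s. (spine_tree s, spine_chain s))
     {s. num_edges (spine_tree s) = n} (chains_in_plane_trees n)"
  unfolding bij_betw_def
proof
  show "inj_on (\<lambda>s. (spine_tree s, spine_chain s)) {s. num_edges (spine_tree s) = n}"
    by (rule inj_onI) (simp add: spine_eqI)
  show "(\<lambda>s. (spine_tree s, spine_chain s)) ` {s. num_edges (spine_tree s) = n}
      = chains_in_plane_trees n"
  proof (intro equalityI subsetI)
    fix X assume "X \<in> chains_in_plane_trees n"
    then obtain T Q where X: "X = (T, Q)" "num_edges T = n" "is_chain T Q"
      by (auto simp: chains_in_plane_trees_def)
    then obtain s where "spine_tree s = T" "spine_chain s = Q"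
      using is_chain_imp_spine by blast
    with X show "X \<in> (\<lambda>s. (spine_tree s, spine_chain s)) ` {s. num_edges (spine_tree s) = n}"
      by (intro image_eqI[of _ _ s]) auto
  qed (auto simp: chains_in_plane_trees_def is_chain_spine)
qed

text \<open>A new first red child extends the initial red run, which is stored in the outermost
  constructor.\<close>

fun spine_prepend :: "plane_tree \<Rightarrow> spine \<Rightarrow> spine" where
  "spine_prepend t (Tip us) = Tip (t # us)"
| "spine_prepend t (Step b ls rs s) = Step b (t # ls) rs s"

fun colored_spine :: "(color \<times> plane_tree) list \<Rightarrow> spine" where
  "colored_spine [] = Tip []"
| "colored_spine ((Red, t) # xs) = spine_prepend t (colored_spine xs)"
| "colored_spine ((Green, t) # xs) = Step True [] (subtrees t) (colored_spine xs)"
| "colored_spine ((Blue, t) # xs) = Step False [] (subtrees t) (colored_spine xs)"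

lemma spine_colored_prepend: "spine_colored (spine_prepend t s) = (Red, t) # spine_colored s"
  by (cases s) auto

lemma spine_colored_colored_spine: "spine_colored (colored_spine xs) = xs"
  by (induction xs rule: colored_spine.induct) (auto simp: spine_colored_prepend)

lemma colored_spine_spine_colored: "colored_spine (spine_colored s) = s"
proof (induction s)
  case (Tip us)
  show ?case by (induction us) auto
next
  case (Step b ls rs s)
  \<comment> \<open>The inner induction peels off the red run \<open>ls\<close>, which
    \<open>spine_prepend\<close> restores tree by tree.\<close>
  then show ?case by (induction ls) auto
qed

lemma bij_betw_spine_colored:
  "bij_betw spine_colored {s. num_edges (spine_tree s) = n} {xs. colored_edges xs = n}"
  by (rule bij_betw_byWitness[where f' = colored_spine])
    (auto simp: spine_colored_colored_spine colored_spine_spine_colored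
      simp flip: colored_edges_spine_colored)

lemma children_root: "children (Node ts) [] = (\<lambda>i. [i]) ` {..<length ts}"
  by (auto simp: children_def vertices_def)

definition tricolored_tree ::
  "(color \<times> plane_tree) list \<Rightarrow> plane_tree \<times> (nat list \<Rightarrow> color)" where
  "tricolored_tree xs =
     (Node (map snd xs), \<lambda>v \<in> children (Node (map snd xs)) []. fst (xs ! hd v))"

definition root_colors ::
  "plane_tree \<times> (nat list \<Rightarrow> color) \<Rightarrow> (color \<times> plane_tree) list" where
  "root_colors = (\<lambda>(T, c). map (\<lambda>i. (c [i], subtrees T ! i)) [0..<length (subtrees T)])"

lemma bij_betw_tricolored_tree:
  "bij_betw tricolored_tree {xs. colored_edges xs = n} (tricolored_plane_trees n)"
proof (rule bij_betw_byWitness[where f' = root_colors])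
  show "\<forall>xs \<in> {xs. colored_edges xs = n}. root_colors (tricolored_tree xs) = xs"
    by (auto simp: root_colors_def tricolored_tree_def children_root intro!: nth_equalityI)
  have snd_root: "map snd (root_colors (T, c)) = subtrees T" for T c
    by (auto simp: root_colors_def intro: nth_equalityI)
  show "\<forall>X \<in> tricolored_plane_trees n. tricolored_tree (root_colors X) = X"
  proof
    fix X assume "X \<in> tricolored_plane_trees n"
    then obtain T c where X: "X = (T, c)" "c \<in> children T [] \<rightarrow>\<^sub>E UNIV"
      by (auto simp: tricolored_plane_trees_def)
    have "fst (root_colors (T, c) ! hd v) = c v" if "v \<in> children T []" for v
      using that by (cases T) (auto simp: children_root root_colors_def)
    \<comment> \<open>Away from the children of the root both sides are \<open>undefined\<close>,
      because \<open>c\<close> is extensional.\<close>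
    then have "(\<lambda>v \<in> children T []. fst (root_colors (T, c) ! hd v)) = c"
      using X(2) by (intro ext) (auto simp: PiE_def extensional_def)
    then show "tricolored_tree (root_colors X) = X"
      by (simp add: X(1) tricolored_tree_def snd_root)
  qed
  show "tricolored_tree ` {xs. colored_edges xs = n} \<subseteq> tricolored_plane_trees n"
    by (auto simp: tricolored_tree_def tricolored_plane_trees_def colored_edges_def)
  show "root_colors ` tricolored_plane_trees n \<subseteq> {xs. colored_edges xs = n}"
    by (auto simp: tricolored_plane_trees_def colored_edges_def snd_root simp del: num_edges.simps)
qed

theorem theorem5p2:
  fixes n :: nat
  shows "\<exists>f. bij_betw f (chains_in_plane_trees n) (tricolored_plane_trees n)"
  \<comment> \<open>The map encodes a chain as its spine, reads the spine as a colored list, and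
    turns the list into a tricolored tree.\<close>
  by (rule exI, rule bij_betw_trans[OF bij_betw_inv_into[OF bij_betw_spine_chains]
      bij_betw_trans[OF bij_betw_spine_colored bij_betw_tricolored_tree]])

end
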